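(* Let $\gamma:\mathbb{S}^1\to\mathbb{R}^+$ be an anisotropic surface energy with Cahn-Hoffman vector $\boldsymbol{\xi}$, let $k:\mathbb{S}^1\to\mathbb{R}^+$, and assume that the surface energy matrix $\boldsymbol{Z}_k(\boldsymbol{n})$ satisfies $$\gamma(\boldsymbol{n})\left[(\hat{\boldsymbol{n}}^\perp)^T\boldsymbol{Z}_k(\boldsymbol{n})\hat{\boldsymbol{n}}^\perp\right]\ge\gamma(\hat{\boldsymbol{n}})^2,\qquad\forall\,\boldsymbol{n},\hat{\boldsymbol{n}}\in\mathbb{S}^1 .$$ Then the scheme SP-PFEM (defined in the context) is unconditionally energy stable: for any time step $\tau>0$ and any solution $(\boldsymbol{X}^m,\mu^m)$, $m\ge0$, of the scheme, $$W_c^{m+1}\le W_c^m\le\cdots\le W_c^0=\sum_{j=1}^N|\boldsymbol{h}_j^0|\,\gamma(\boldsymbol{n}_j^0),\qquad\forall m\ge0 .$$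
   Context: Notation. $\mathbb{S}^1\subset\mathbb{R}^2$ is the unit circle, $\mathbb{R}^+=(0,\infty)$, and $^\perp$ denotes clockwise rotation by $\pi/2$, i.e. $(a,b)^\perp=(b,-a)$. A function $\gamma:\mathbb{S}^1\to\mathbb{R}^+$ is extended to $\mathbb{R}^2$ by $\gamma(\boldsymbol{p})=|\boldsymbol{p}|\gamma(\boldsymbol{p}/|\boldsymbol{p}|)$ for $\boldsymbol{p}\ne\boldsymbol{0}$ and $\gamma(\boldsymbol{0})=0$; it is assumed differentiable away from the origin. The Cahn-Hoffman vector is $\boldsymbol{\xi}(\boldsymbol{n})=\nabla\gamma(\boldsymbol{p})|_{\boldsymbol{p}=\boldsymbol{n}}$. For $k:\mathbb{S}^1\to\mathbb{R}^+$ the surface energy matrix is $$\boldsymbol{Z}_k(\boldsymbol{n})=\gamma(\boldsymbol{n})I_2-\boldsymbol{n}\boldsymbol{\xi}(\boldsymbol{n})^T-\boldsymbol{\xi}(\boldsymbol{n})\boldsymbol{n}^T+k(\boldsymbol{n})\boldsymbol{n}\boldsymbol{n}^T .$$ Discretization. $\mathbb{T}=\mathbb{R}/\mathbb{Z}=[0,1]$ (periodic), $N$ a positive integer, $h=1/N$, $\rho_j=jh$ ($0\le j\le N$), $I_j=[\rho_{j-1},\rho_j]$, and $\mathbb{K}^h=\{u\in C(\mathbb{T}): u|_{I_j}\text{ is a polynomial of degree}\le 1,\ j=1,\dots,N\}$. For $m\ge 0$, $\boldsymbol{X}^m\in[\mathbb{K}^h]^2$ parametrizes a closed polygonal curve $\Gamma^m=\boldsymbol{X}^m(\mathbb{T})$;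 $\boldsymbol{h}_j^m=\boldsymbol{X}^m(\rho_j)-\boldsymbol{X}^m(\rho_{j-1})$, assumed nonzero for all $j,m$; $\boldsymbol{n}^m|_{I_j}=\boldsymbol{n}_j^m=-(\boldsymbol{h}_j^m)^\perp/|\boldsymbol{h}_j^m|$. For $f\in\mathbb{K}^h$ or $[\mathbb{K}^h]^2$, $\partial_s f=|\partial_\rho\boldsymbol{X}^m|^{-1}\partial_\rho f$ (arclength derivative on $\Gamma^m$, piecewise constant). For piecewise continuous (scalar- or vector-valued) $u,v$, the mass lumped inner product is $$(u,v)^h_{\Gamma^m}=\frac12\sum_{j=1}^N|\boldsymbol{h}_j^m|\left[(u\cdot v)(\rho_j^-)+(u\cdot v)(\rho_{j-1}^+)\right],$$ with one-sided limits at the nodes. Put $\boldsymbol{n}^{m+\frac12}=-\frac12(\partial_s\boldsymbol{X}^m+\partial_s\boldsymbol{X}^{m+1})^\perp$. SP-PFEM with time step $\tau>0$: given $\boldsymbol{X}^0\in[\mathbb{K}^h]^2$, for each $m\ge0$, $\boldsymbol{X}^{m+1}\in[\mathbb{K}^h]^2$ and $\mu^{m+1}\in\mathbb{K}^h$ satisfy $$\Bigl(\tfrac{\boldsymbol{X}^{m+1}-\boldsymbol{X}^m}{\tau}\cdot\boldsymbol{n}^{m+\frac12},\varphi^h\Bigr)^h_{\Gamma^m}+\bigl(\partial_s\mu^{m+1},\partial_s\varphi^h\bigr)^h_{\Gamma^m}=0\quad\forall\varphi^h\in\mathbb{K}^h,$$ $$\bigl(\mu^{m+1},\boldsymbol{n}^{m+\frac12}\cdot\boldsymbol{\omega}^h\bigr)^h_{\Gamma^m}-\bigl(\boldsymbol{Z}_k(\boldsymbol{n}^m)\partial_s\boldsymbol{X}^{m+1},\partial_s\boldsymbol{\omega}^h\bigr)^h_{\Gamma^m}=0\quad\forall\boldsymbol{\omega}^h\in[\mathbb{K}^h]^2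 .$$ Energy: $W_c^m=\sum_{j=1}^N|\boldsymbol{h}_j^m|\gamma(\boldsymbol{n}_j^m)$. *)

theory Defs
  imports "HOL-Analysis.Analysis" "HOL-Computational_Algebra.Polynomial"
begin

text \<open>The unit circle is \<^term>\<open>sphere (0 :: real^2) 1\<close>. A function on it is represented by a
  function on the plane of which only the values on the circle are used.\<close>

definition perp :: "real^2 \<Rightarrow> real^2" where
  "perp p = vector [p $ 2, - (p $ 1)]"

definition outer :: "real^2 \<Rightarrow> real^2 \<Rightarrow> real^2^2" where
  "outer u v = (\<chi> i j. u $ i * v $ j)"

definition hom_ext :: "(real^2 \<Rightarrow> real) \<Rightarrow> real^2 \<Rightarrow> real" where
  "hom_ext \<gamma> p = (if p = 0 then 0 else norm p * \<gamma> (p /\<^sub>R norm p))"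

definition anisotropy :: "(real^2 \<Rightarrow> real) \<Rightarrow> bool" where
  "anisotropy \<gamma> \<longleftrightarrow>
     (\<forall>n\<in>sphere 0 1. \<gamma> n > 0) \<and> (\<forall>p. p \<noteq> 0 \<longrightarrow> hom_ext \<gamma> differentiable (at p))"

definition cahn_hoffman :: "(real^2 \<Rightarrow> real) \<Rightarrow> real^2 \<Rightarrow> real^2" where
  "cahn_hoffman \<gamma> n = (THE g. GDERIV (hom_ext \<gamma>) n :> g)"

definition energy_matrix :: "(real^2 \<Rightarrow> real) \<Rightarrow> (real^2 \<Rightarrow> real) \<Rightarrow> real^2 \<Rightarrow> real^2^2" where
  "energy_matrix \<gamma> k n =
     \<gamma> n *\<^sub>R mat 1 - outer n (cahn_hoffman \<gamma> n) - outer (cahn_hoffman \<gamma> n) n + k n *\<^sub>R outer n n"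

text \<open>Functions on the torus \<open>\<real>/\<int>\<close> are represented by functions on the real line of period 1.
  Nodes and edges are indexed by all integers, consistently with this periodicity; the indices
  \<open>1, \<dots>, N\<close> cover one period.\<close>

definition node :: "nat \<Rightarrow> int \<Rightarrow> real" where
  "node N j = of_int j / real N"

definition Kh :: "nat \<Rightarrow> (real \<Rightarrow> real) set" where
  "Kh N = {u. continuous_on UNIV u \<and> (\<forall>\<rho>. u (\<rho> + 1) = u \<rho>) \<and>
     (\<forall>j\<in>{1..int N}. \<exists>p :: real poly. degree p \<le> 1 \<and>
        (\<forall>\<rho>\<in>{node N (j - 1)..node N j}. u \<rho> = poly p \<rho>))}"

definition Kh2 :: "nat \<Rightarrow> (real \<Rightarrow> real^2) set" where
  "Kh2 N = {v. \<forall>i. (\<lambda>\<rho>. v \<rho> $ i) \<in> Kh N}"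

definition edge :: "nat \<Rightarrow> (real \<Rightarrow> real^2) \<Rightarrow> int \<Rightarrow> real^2" where
  "edge N X j = X (node N j) - X (node N (j - 1))"

definition edge_normal :: "nat \<Rightarrow> (real \<Rightarrow> real^2) \<Rightarrow> int \<Rightarrow> real^2" where
  "edge_normal N X j = - (perp (edge N X j) /\<^sub>R norm (edge N X j))"

text \<open>The piecewise constant normal: \<open>\<lceil>N \<rho>\<rceil>\<close> is the index of the edge whose parameter interval
  contains \<open>\<rho>\<close>. At a node, where two intervals meet, the left one is chosen; the lumped inner
  product below sees only one-sided limits, so this choice is immaterial.\<close>

definition normal :: "nat \<Rightarrow> (real \<Rightarrow> real^2) \<Rightarrow> real \<Rightarrow> real^2" where
  "normal N X \<rho> = edge_normal N X \<lceil>real N * \<rho>\<rceil>"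

text \<open>Arclength derivative on the curve parametrized by \<open>X\<close>; it is meaningful only between nodes,
  which is again all that the one-sided limits see.\<close>

definition arc_deriv :: "(real \<Rightarrow> real^2) \<Rightarrow> (real \<Rightarrow> 'a::real_normed_vector) \<Rightarrow> real \<Rightarrow> 'a" where
  "arc_deriv X f \<rho> = vector_derivative f (at \<rho>) /\<^sub>R norm (vector_derivative X (at \<rho>))"

text \<open>For scalar-valued functions the inner product \<open>\<bullet>\<close> on \<^typ>\<open>real\<close> is multiplication.\<close>

definition lumped_inner ::
    "nat \<Rightarrow> (real \<Rightarrow> real^2) \<Rightarrow> (real \<Rightarrow> 'a::real_inner) \<Rightarrow> (real \<Rightarrow> 'a) \<Rightarrow> real" where
  "lumped_inner N X u v = 1/2 * (\<Sum>j=1..int N. norm (edge N X j) *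
     (Lim (at_left (node N j)) (\<lambda>\<rho>. u \<rho> \<bullet> v \<rho>) +
      Lim (at_right (node N (j - 1))) (\<lambda>\<rho>. u \<rho> \<bullet> v \<rho>)))"

definition half_normal :: "(real \<Rightarrow> real^2) \<Rightarrow> (real \<Rightarrow> real^2) \<Rightarrow> real \<Rightarrow> real^2" where
  "half_normal X X' \<rho> = - ((1/2) *\<^sub>R perp (arc_deriv X X \<rho> + arc_deriv X X' \<rho>))"

text \<open>One time step, from \<open>X\<close> to \<open>(X', \<mu>')\<close>.\<close>

definition SP_PFEM_step ::
    "(real^2 \<Rightarrow> real) \<Rightarrow> (real^2 \<Rightarrow> real) \<Rightarrow> nat \<Rightarrow> real \<Rightarrow>
     (real \<Rightarrow> real^2) \<Rightarrow> (real \<Rightarrow> real^2) \<Rightarrow> (real \<Rightarrow> real) \<Rightarrow> bool" where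
  "SP_PFEM_step \<gamma> k N \<tau> X X' \<mu>' \<longleftrightarrow>
     X' \<in> Kh2 N \<and> \<mu>' \<in> Kh N \<and>
     (\<forall>\<phi>\<in>Kh N.
        lumped_inner N X (\<lambda>\<rho>. ((X' \<rho> - X \<rho>) /\<^sub>R \<tau>) \<bullet> half_normal X X' \<rho>) \<phi>
        + lumped_inner N X (arc_deriv X \<mu>') (arc_deriv X \<phi>) = 0) \<and>
     (\<forall>\<omega>\<in>Kh2 N.
        lumped_inner N X \<mu>' (\<lambda>\<rho>. half_normal X X' \<rho> \<bullet> \<omega> \<rho>)
        - lumped_inner N X (\<lambda>\<rho>. energy_matrix \<gamma> k (normal N X \<rho>) *v arc_deriv X X' \<rho>)
            (arc_deriv X \<omega>) = 0)"

text \<open>The nondegeneracy \<open>edge N (X m) j \<noteq> 0\<close> is part of being a solution; \<open>\<mu> 0\<close> plays no role.\<close>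

definition SP_PFEM_solution ::
    "(real^2 \<Rightarrow> real) \<Rightarrow> (real^2 \<Rightarrow> real) \<Rightarrow> nat \<Rightarrow> real \<Rightarrow>
     (nat \<Rightarrow> real \<Rightarrow> real^2) \<Rightarrow> (nat \<Rightarrow> real \<Rightarrow> real) \<Rightarrow> bool" where
  "SP_PFEM_solution \<gamma> k N \<tau> X \<mu> \<longleftrightarrow>
     X 0 \<in> Kh2 N \<and>
     (\<forall>m. \<forall>j\<in>{1..int N}. edge N (X m) j \<noteq> 0) \<and>
     (\<forall>m. SP_PFEM_step \<gamma> k N \<tau> (X m) (X (Suc m)) (\<mu> (Suc m)))"

definition energy :: "(real^2 \<Rightarrow> real) \<Rightarrow> nat \<Rightarrow> (real \<Rightarrow> real^2) \<Rightarrow> real" where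
  "energy \<gamma> N X = (\<Sum>j=1..int N. norm (edge N X j) * \<gamma> (edge_normal N X j))"

end

theory Submission
  imports Defs
begin

text \<open>
  Testing the first equation with \<open>\<mu>'\<close> and the second with \<open>\<omega> = (X' - X) / \<tau>\<close> shows that
  the sum over the edges of \<open>Z h' \<bullet> (h' - h) / |h|\<close> equals \<open>- \<tau> (\<partial>\<^sub>s\<mu>', \<partial>\<^sub>s\<mu>')\<close>, hence is
  nonpositive. The matrix \<open>Z\<close> is symmetric, and the hypothesis makes it positive semidefinite, so that
  \<open>Z h' \<bullet> (h' - h) \<ge> (h' \<bullet> Z h' - h \<bullet> Z h) / 2\<close>. Here \<open>h \<bullet> Z h = |h|\<^sup>2 \<gamma>(n)\<close>, because the edge
  is orthogonal to its normal, and \<open>h' \<bullet> Z h' \<ge> |h'|\<^sup>2 \<gamma>(n')\<^sup>2 / \<gamma>(n)\<close> by hypothesis. With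
  \<open>a = |h'| \<gamma>(n')\<close> and \<open>b = |h| \<gamma>(n)\<close>, each term is at least \<open>(a\<^sup>2 / b - b) / 2 \<ge> a - b\<close>.
\<close>

section \<open>Piecewise affine functions, their arclength derivatives, and lumped products\<close>

lemma node_less: "N > 0 \<Longrightarrow> node N (j - 1) < node N j"
  by (simp add: node_def divide_strict_right_mono)

lemma Kh_scaled_diff:
  assumes "u \<in> Kh N" "v \<in> Kh N"
  shows "(\<lambda>\<rho>. c * (u \<rho> - v \<rho>)) \<in> Kh N"
proof -
  have "\<exists>p :: real poly. degree p \<le> 1 \<and>
      (\<forall>\<rho>\<in>{node N (j - 1)..node N j}. c * (u \<rho> - v \<rho>) = poly p \<rho>)" if j: "j \<in> {1..int N}" for j
  proof -
    obtain p where p: "degree p \<le> 1" "\<forall>\<rho>\<in>{node N (j - 1)..node N j}. u \<rho> = poly p \<rho>"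
      using assms(1) j unfolding Kh_def by blast
    obtain q where q: "degree q \<le> 1" "\<forall>\<rho>\<in>{node N (j - 1)..node N j}. v \<rho> = poly q \<rho>"
      using assms(2) j unfolding Kh_def by blast
    have "degree (smult c (p - q)) \<le> 1"
      using degree_smult_le[of c "p - q"] degree_diff_le[OF p(1) q(1)] by linarith
    moreover have "\<forall>\<rho>\<in>{node N (j - 1)..node N j}. c * (u \<rho> - v \<rho>) = poly (smult c (p - q)) \<rho>"
      using p(2) q(2) by simp
    ultimately show ?thesis by blast
  qed
  then show ?thesis
    using assms unfolding Kh_def by (auto intro!: continuous_intros)
qed

text \<open>Makes the discrete velocity \<open>(X' - X) / \<tau>\<close> an admissible test
  function.\<close>

lemma Kh2_scaled_diff:
  assumes "V \<in> Kh2 N" "U \<in> Kh2 N"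
  shows "(\<lambda>\<rho>. c *\<^sub>R (V \<rho> - U \<rho>)) \<in> Kh2 N"
  using assms Kh_scaled_diff[of _ N _ c] by (simp add: Kh2_def)

text \<open>A polynomial of degree at most 1 is determined by its values at the two ends of the
  interval; \<open>real N\<close> is the reciprocal of the interval length.\<close>

lemma Kh_affine:
  assumes "u \<in> Kh N" "N > 0" "j \<in> {1..int N}" "\<rho> \<in> {node N (j - 1)..node N j}"
  shows "u \<rho> = u (node N (j - 1))
    + (real N * (\<rho> - node N (j - 1))) * (u (node N j) - u (node N (j - 1)))"
proof -
  obtain p where p: "degree p \<le> 1" "\<forall>\<rho>\<in>{node N (j - 1)..node N j}. u \<rho> = poly p \<rho>"
    using assms(1,3) unfolding Kh_def by blast
  obtain a b where ab: "p = [:a, b:]"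
  proof (cases p)
    case (pCons a q)
    then show ?thesis using p(1) that by (cases q) (auto split: if_splits)
  qed
  have u: "u x = a + b * x" if "x \<in> {node N (j - 1)..node N j}" for x
    using p(2) that by (simp add: ab mult.commute)
  \<comment> \<open>Multiplying by this 1 turns the unknown slope \<open>b\<close> into a difference
    of nodal values.\<close>
  have "real N * (node N j - node N (j - 1)) = 1"
    using assms(2) by (simp add: node_def field_simps)
  then have "b * (\<rho> - node N (j - 1)) = b * (\<rho> - node N (j - 1)) * (real N * (node N j - node N (j - 1)))"
    by simp
  then show ?thesis
    using u[OF assms(4)] u[of "node N j"] u[of "node N (j - 1)"] node_less[OF assms(2), of j]
    by (simp add: algebra_simps)
qed

lemma Kh2_affine:
  assumes "U \<in> Kh2 N" "N > 0" "j \<in> {1..int N}" "\<rho> \<in> {node N (j - 1)..node N j}"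
  shows "U \<rho> = U (node N (j - 1)) + (real N * (\<rho> - node N (j - 1))) *\<^sub>R edge N U j"
proof -
  have "U \<rho> $ i = (U (node N (j - 1)) + (real N * (\<rho> - node N (j - 1))) *\<^sub>R edge N U j) $ i" for i
    using Kh_affine[of "\<lambda>\<rho>. U \<rho> $ i" N j \<rho>] assms by (simp add: Kh2_def edge_def)
  then show ?thesis by (simp add: vec_eq_iff)
qed

text \<open>The open interval is a neighbourhood of \<open>\<rho>\<close>, so agreement there fixes
  the derivative. The form with \<open>*\<^sub>R\<close> serves scalar and vector functions
  alike.\<close>

lemma vector_derivative_affine:
  assumes "\<rho> \<in> {a<..<b}" and "\<And>x. x \<in> {a..b} \<Longrightarrow> f x = w + (c * (x - a)) *\<^sub>R d"
  shows "vector_derivative f (at \<rho>) = c *\<^sub>R d"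
proof (rule vector_derivative_at)
  have "((\<lambda>x. w + (c * (x - a)) *\<^sub>R d) has_vector_derivative c *\<^sub>R d) (at \<rho>)"
    by (auto intro!: derivative_eq_intros)
  then show "(f has_vector_derivative c *\<^sub>R d) (at \<rho>)"
    by (rule has_vector_derivative_transform_within_open[where S = "{a<..<b}"])
      (use assms in auto)
qed

lemma vector_derivative_Kh:
  assumes "u \<in> Kh N" "N > 0" "j \<in> {1..int N}" "\<rho> \<in> {node N (j - 1)<..<node N j}"
  shows "vector_derivative u (at \<rho>) = real N * (u (node N j) - u (node N (j - 1)))"
proof -
  have "vector_derivative u (at \<rho>) = real N *\<^sub>R (u (node N j) - u (node N (j - 1)))"
    by (rule vector_derivative_affine[OF assms(4), where w = "u (node N (j - 1))"])
      (unfold real_scaleR_def, rule Kh_affine[OF assms(1-3)])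
  then show ?thesis by simp
qed

lemma vector_derivative_Kh2:
  assumes "U \<in> Kh2 N" "N > 0" "j \<in> {1..int N}" "\<rho> \<in> {node N (j - 1)<..<node N j}"
  shows "vector_derivative U (at \<rho>) = real N *\<^sub>R edge N U j"
  by (rule vector_derivative_affine[OF assms(4)]) (rule Kh2_affine[OF assms(1-3)])

lemma arc_deriv_Kh:
  assumes "X \<in> Kh2 N" "u \<in> Kh N" "N > 0" "j \<in> {1..int N}" "\<rho> \<in> {node N (j - 1)<..<node N j}"
  shows "arc_deriv X u \<rho> = (u (node N j) - u (node N (j - 1))) / norm (edge N X j)"
  using assms(3) unfolding arc_deriv_def vector_derivative_Kh[OF assms(2-5)]
    vector_derivative_Kh2[OF assms(1,3-5)]
  by (simp add: divide_inverse mult.commute)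

lemma arc_deriv_Kh2:
  assumes "X \<in> Kh2 N" "U \<in> Kh2 N" "N > 0" "j \<in> {1..int N}" "\<rho> \<in> {node N (j - 1)<..<node N j}"
  shows "arc_deriv X U \<rho> = edge N U j /\<^sub>R norm (edge N X j)"
  using assms(3) by (simp add: arc_deriv_def vector_derivative_Kh2[OF assms(1,3-5)]
      vector_derivative_Kh2[OF assms(2-5)])

lemma normal_eq_edge_normal:
  assumes "N > 0" "\<rho> \<in> {node N (j - 1)<..<node N j}"
  shows "normal N X \<rho> = edge_normal N X j"
proof -
  have "\<lceil>real N * \<rho>\<rceil> = j"
    using assms by (intro ceiling_unique) (auto simp: node_def field_simps)
  then show ?thesis by (simp add: normal_def)
qed

text \<open>The one-sided limits see only the open interval, where the product is constant; both
  equal \<open>c j\<close>, which cancels the factor \<open>1/2\<close>.\<close>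

lemma lumped_inner_piecewise_const:
  assumes "N > 0"
    and const: "\<And>j \<rho>. j \<in> {1..int N} \<Longrightarrow> \<rho> \<in> {node N (j - 1)<..<node N j} \<Longrightarrow> u \<rho> \<bullet> v \<rho> = c j"
  shows "lumped_inner N X u v = (\<Sum>j=1..int N. norm (edge N X j) * c j)"
proof -
  have "Lim (at_left (node N j)) (\<lambda>\<rho>. u \<rho> \<bullet> v \<rho>) = c j \<and>
      Lim (at_right (node N (j - 1))) (\<lambda>\<rho>. u \<rho> \<bullet> v \<rho>) = c j" if j: "j \<in> {1..int N}" for j
  proof (intro conjI tendsto_Lim)
    have "\<forall>\<^sub>F \<rho> in at_left (node N j). u \<rho> \<bullet> v \<rho> = c j"
      using eventually_at_left_real[OF node_less[OF assms(1), of j]]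
      by eventually_elim (rule const[OF j])
    then show "((\<lambda>\<rho>. u \<rho> \<bullet> v \<rho>) \<longlongrightarrow> c j) (at_left (node N j))"
      by (rule tendsto_eventually)
    have "\<forall>\<^sub>F \<rho> in at_right (node N (j - 1)). u \<rho> \<bullet> v \<rho> = c j"
      using eventually_at_right_real[OF node_less[OF assms(1), of j]]
      by eventually_elim (rule const[OF j])
    then show "((\<lambda>\<rho>. u \<rho> \<bullet> v \<rho>) \<longlongrightarrow> c j) (at_right (node N (j - 1)))"
      by (rule tendsto_eventually)
  qed simp_all
  then show ?thesis
    unfolding lumped_inner_def sum_distrib_left by (intro sum.cong) simp_all
qed

section \<open>The quadratic form of the surface energy matrix\<close>

text \<open>The two mixed outer products are transposes of each other, and the other terms are
  symmetric.\<close>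

lemma energy_matrix_sym:
  "u \<bullet> (energy_matrix \<gamma> k n *v v) = v \<bullet> (energy_matrix \<gamma> k n *v u)"
  by (simp add: energy_matrix_def outer_def mat_def inner_vec_def matrix_vector_mult_def sum_2
      algebra_simps)

text \<open>Each outer product has a factor \<open>n\<close>, which is orthogonal to
  \<open>perp n\<close>; only the multiple of the identity survives.\<close>

lemma perp_energy_matrix_perp:
  assumes "norm n = 1"
  shows "perp n \<bullet> (energy_matrix \<gamma> k n *v perp n) = \<gamma> n"
proof -
  have "n $ 1 * n $ 1 + n $ 2 * n $ 2 = 1"
    using assms by (simp add: norm_eq_1 inner_vec_def sum_2)
  moreover have "perp n \<bullet> (energy_matrix \<gamma> k n *v perp n) = \<gamma> n * (n $ 1 * n $ 1 + n $ 2 * n $ 2)"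
    by (simp add: energy_matrix_def perp_def outer_def mat_def inner_vec_def
        matrix_vector_mult_def sum_2 algebra_simps)
  ultimately show ?thesis by simp
qed

lemma norm_perp [simp]: "norm (perp p) = norm p"
  by (simp add: perp_def norm_vec_def L2_set_def sum_2 add.commute)

lemma norm_edge_normal:
  "edge N X j \<noteq> 0 \<Longrightarrow> norm (edge_normal N X j) = 1"
  by (simp add: edge_normal_def)

text \<open>Rotating twice by a right angle gives a minus sign, which cancels the one in
  \<open>edge_normal\<close>.\<close>

lemma edge_eq_perp_edge_normal:
  assumes "edge N X j \<noteq> 0"
  shows "edge N X j = norm (edge N X j) *\<^sub>R perp (edge_normal N X j)"
  using assms by (simp add: edge_normal_def perp_def vec_eq_iff forall_2)

text \<open>The estimate on a single edge: \<open>h\<close> and \<open>h'\<close> are the old and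
  new edge, \<open>r\<close> and \<open>r'\<close> their lengths. Both divisions are by the old
  length \<open>r\<close> because arclength is taken on the old curve.\<close>

lemma energy_matrix_edge_inequality:
  assumes pos: "\<forall>n\<in>sphere 0 1. \<gamma> n > 0"
    and Z: "\<forall>n\<in>sphere 0 1. \<forall>n'\<in>sphere 0 1.
           \<gamma> n * (perp n' \<bullet> (energy_matrix \<gamma> k n *v perp n')) \<ge> (\<gamma> n')\<^sup>2"
    and n: "norm n = 1" and n': "norm n' = 1" and r: "r > 0" and r': "r' > 0"
    and h: "h = r *\<^sub>R perp n" and h': "h' = r' *\<^sub>R perp n'"
  shows "r * ((energy_matrix \<gamma> k n *v (h' /\<^sub>R r)) \<bullet> ((h' - h) /\<^sub>R r)) \<ge> r' * \<gamma> n' - r * \<gamma> n"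
proof -
  define Q where "Q u v = u \<bullet> (energy_matrix \<gamma> k n *v v)" for u v
  have add: "Q u (v + w) = Q u v + Q u w" "Q (u + v) w = Q u w + Q v w"
    and scale: "Q (c *\<^sub>R u) v = c * Q u v" "Q u (c *\<^sub>R v) = c * Q u v" for u v w c
    by (simp_all add: Q_def matrix_vector_right_distrib inner_add matrix_vector_mult_scaleR)
  have diff: "Q u (v - w) = Q u v - Q u w" "Q (u - v) w = Q u w - Q v w" for u v w
    by (simp_all add: Q_def matrix_vector_mult_diff_distrib inner_diff)
  have sym: "Q u v = Q v u" for u v
    unfolding Q_def by (rule energy_matrix_sym)
  have gn: "\<gamma> n > 0" using pos n by simp
  have lower: "\<gamma> n * Q (perp m) (perp m) \<ge> (\<gamma> m)\<^sup>2" if "norm m = 1" for m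
    using Z n that by (simp add: Q_def)
  have nonneg: "Q u u \<ge> 0" for u
  proof (cases "u = 0")
    case True
    then show ?thesis by (simp add: Q_def)
  next
    case False
    \<comment> \<open>The hypothesis concerns \<open>perp\<close> of unit vectors only; this
      \<open>m\<close> is the unit vector for which \<open>u\<close> is a nonnegative multiple of
      \<open>perp m\<close>.\<close>
    define m where "m = - perp u /\<^sub>R norm u"
    have "norm m = 1" using False by (simp add: m_def)
    moreover have "u = norm u *\<^sub>R perp m"
      using False by (simp add: m_def perp_def vec_eq_iff forall_2)
    moreover have "Q (perp m) (perp m) \<ge> 0"
      using lower[OF \<open>norm m = 1\<close>] gn by (meson order_trans zero_le_power2 zero_le_mult_iff not_le)
    ultimately show ?thesis
      by (metis scale mult_nonneg_nonneg norm_ge_zero)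
  qed
  have "Q (h' - h) (h' - h) \<ge> 0" by (rule nonneg)
  \<comment> \<open>By symmetry, \<open>Q (h' - h) h'\<close> exceeds the right-hand side by exactly
    half of \<open>Q (h' - h) (h' - h)\<close>.\<close>
  then have half: "Q (h' - h) h' \<ge> (Q h' h' - Q h h) / 2"
    using sym[of h h'] by (simp add: diff)
  have Qh: "Q h h = r\<^sup>2 * \<gamma> n"
    using perp_energy_matrix_perp[OF n, of \<gamma> k] by (simp only: Q_def[symmetric]) (simp add: h scale power2_eq_square)
  have Qh': "\<gamma> n * Q h' h' \<ge> (r' * \<gamma> n')\<^sup>2"
    using mult_left_mono[OF lower[OF n'], of "r'\<^sup>2"]
    by (simp add: h' scale power2_eq_square algebra_simps)
  \<comment> \<open>The bound \<open>2 a b \<le> a^2 + b^2\<close> is kept free of division, so that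
    the positive factor \<open>\<gamma> n\<close> can be cancelled at the end.\<close>
  have "2 * (r * \<gamma> n) * (r' * \<gamma> n') \<le> (r' * \<gamma> n')\<^sup>2 + (r * \<gamma> n)\<^sup>2"
    using sum_squares_bound[of "r * \<gamma> n" "r' * \<gamma> n'"] by linarith
  also have "\<dots> \<le> \<gamma> n * Q h' h' + (r * \<gamma> n)\<^sup>2"
    using Qh' by simp
  also have "\<dots> = \<gamma> n * (Q h' h' + r\<^sup>2 * \<gamma> n)"
    by (simp add: power2_eq_square algebra_simps)
  finally have "\<gamma> n * (2 * r * (r' * \<gamma> n')) \<le> \<gamma> n * (Q h' h' + r\<^sup>2 * \<gamma> n)"
    by (simp add: algebra_simps)
  then have "2 * r * (r' * \<gamma> n') \<le> Q h' h' + r\<^sup>2 * \<gamma> n"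
    using gn by simp
  then have "r * (r' * \<gamma> n' - r * \<gamma> n) \<le> Q (h' - h) h'"
    using half Qh by (simp add: power2_eq_square algebra_simps)
  then have "r' * \<gamma> n' - r * \<gamma> n \<le> Q (h' - h) h' / r"
    using r by (simp add: field_simps)
  also have "Q (h' - h) h' / r = r * Q ((h' - h) /\<^sub>R r) (h' /\<^sub>R r)"
    unfolding scale using r by (simp add: field_simps)
  finally show ?thesis by (simp only: Q_def inner_commute)
qed

section \<open>Energy decay of the scheme\<close>

lemma SP_PFEM_step_energy_le:
  assumes pos: "\<forall>n\<in>sphere 0 1. \<gamma> n > 0"
    and Z: "\<forall>n\<in>sphere 0 1. \<forall>n'\<in>sphere 0 1.
           \<gamma> n * (perp n' \<bullet> (energy_matrix \<gamma> k n *v perp n')) \<ge> (\<gamma> n')\<^sup>2"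
    and N: "N > 0" and \<tau>: "\<tau> > 0" and X: "X \<in> Kh2 N"
    and nz: "\<forall>j\<in>{1..int N}. edge N X j \<noteq> 0" "\<forall>j\<in>{1..int N}. edge N X' j \<noteq> 0"
    and step: "SP_PFEM_step \<gamma> k N \<tau> X X' \<mu>'"
  shows "energy \<gamma> N X' \<le> energy \<gamma> N X"
proof -
  define \<omega> where "\<omega> \<rho> = inverse \<tau> *\<^sub>R (X' \<rho> - X \<rho>)" for \<rho>
  define Zj where "Zj j = energy_matrix \<gamma> k (edge_normal N X j)" for j
  define D where "D j = norm (edge N X j) * ((Zj j *v (edge N X' j /\<^sub>R norm (edge N X j))) \<bullet>
      ((edge N X' j - edge N X j) /\<^sub>R norm (edge N X j)))" for j
  have X': "X' \<in> Kh2 N" and \<mu>': "\<mu>' \<in> Kh N" using step by (auto simp: SP_PFEM_step_def)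
  have \<omega>: "\<omega> \<in> Kh2 N" unfolding \<omega>_def by (rule Kh2_scaled_diff[OF X' X])
  have edge_\<omega>: "edge N \<omega> j = inverse \<tau> *\<^sub>R (edge N X' j - edge N X j)" for j
    by (simp add: \<omega>_def edge_def algebra_simps)
  \<comment> \<open>With these test functions the term pairing velocity and chemical potential is
    the same in both equations, so it can be eliminated.\<close>
  have "lumped_inner N X (\<lambda>\<rho>. ((X' \<rho> - X \<rho>) /\<^sub>R \<tau>) \<bullet> half_normal X X' \<rho>) \<mu>'
      = lumped_inner N X \<mu>' (\<lambda>\<rho>. half_normal X X' \<rho> \<bullet> \<omega> \<rho>)"
    by (simp add: lumped_inner_def \<omega>_def inner_commute mult.commute)
  then have balance: "lumped_inner N X (\<lambda>\<rho>. energy_matrix \<gamma> k (normal N X \<rho>) *v arc_deriv X X' \<rho>)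
      (arc_deriv X \<omega>) = - lumped_inner N X (arc_deriv X \<mu>') (arc_deriv X \<mu>')"
    using step \<mu>' \<omega> unfolding SP_PFEM_step_def by force
  have "lumped_inner N X (arc_deriv X \<mu>') (arc_deriv X \<mu>') = (\<Sum>j=1..int N. norm (edge N X j) *
      ((\<mu>' (node N j) - \<mu>' (node N (j - 1))) / norm (edge N X j))\<^sup>2)"
    by (rule lumped_inner_piecewise_const[OF N])
      (simp add: arc_deriv_Kh[OF X \<mu>' N] power2_eq_square)
  also have "\<dots> \<ge> 0" by (intro sum_nonneg) simp
  finally have dissipation: "lumped_inner N X (arc_deriv X \<mu>') (arc_deriv X \<mu>') \<ge> 0" .
  have "lumped_inner N X (\<lambda>\<rho>. energy_matrix \<gamma> k (normal N X \<rho>) *v arc_deriv X X' \<rho>) (arc_deriv X \<omega>)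
      = (\<Sum>j=1..int N. norm (edge N X j) * ((Zj j *v (edge N X' j /\<^sub>R norm (edge N X j))) \<bullet>
          (edge N \<omega> j /\<^sub>R norm (edge N X j))))"
    by (rule lumped_inner_piecewise_const[OF N])
      (simp only: arc_deriv_Kh2[OF X X' N] arc_deriv_Kh2[OF X \<omega> N] normal_eq_edge_normal[OF N] Zj_def)
  \<comment> \<open>The time step enters linearly through \<open>\<omega>\<close>, so only its sign
    matters below.\<close>
  also have "\<dots> = inverse \<tau> * (\<Sum>j=1..int N. D j)"
    unfolding sum_distrib_left D_def edge_\<omega> by (intro sum.cong) simp_all
  finally have "inverse \<tau> * (\<Sum>j=1..int N. D j) \<le> 0"
    using balance dissipation by linarith
  then have D: "(\<Sum>j=1..int N. D j) \<le> 0"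
    using \<tau> by (simp add: field_simps)
  have "norm (edge N X' j) * \<gamma> (edge_normal N X' j) - norm (edge N X j) * \<gamma> (edge_normal N X j) \<le> D j"
    if "j \<in> {1..int N}" for j
    unfolding D_def Zj_def using nz that
    by (intro energy_matrix_edge_inequality[OF pos Z] edge_eq_perp_edge_normal norm_edge_normal)
      auto
  then have "(\<Sum>j=1..int N. norm (edge N X' j) * \<gamma> (edge_normal N X' j)
      - norm (edge N X j) * \<gamma> (edge_normal N X j)) \<le> (\<Sum>j=1..int N. D j)"
    by (rule sum_mono)
  then show ?thesis using D by (simp add: energy_def sum_subtractf)
qed

theorem theorem4p5:
  fixes \<gamma> k :: "real^2 \<Rightarrow> real" and N :: nat and \<tau> :: real
    and X :: "nat \<Rightarrow> real \<Rightarrow> real^2" and \<mu> :: "nat \<Rightarrow> real \<Rightarrow> real"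
  assumes "anisotropy \<gamma>"
    and "\<forall>n\<in>sphere 0 1. k n > 0"
    and "\<forall>n\<in>sphere 0 1. \<forall>n'\<in>sphere 0 1.
           \<gamma> n * (perp n' \<bullet> (energy_matrix \<gamma> k n *v perp n')) \<ge> (\<gamma> n')\<^sup>2"
    and "N > 0"
    and "\<tau> > 0"
    and "SP_PFEM_solution \<gamma> k N \<tau> X \<mu>"
  shows "\<forall>m. energy \<gamma> N (X (Suc m)) \<le> energy \<gamma> N (X m)
           \<and> energy \<gamma> N (X m) \<le> energy \<gamma> N (X 0)
           \<and> energy \<gamma> N (X 0)
               = (\<Sum>j=1..int N. norm (edge N (X 0) j) * \<gamma> (edge_normal N (X 0) j))"
proof -
  note sol = assms(6)[unfolded SP_PFEM_solution_def]
  \<comment> \<open>For \<open>m = 0\<close> this is the initial condition; otherwise it comes from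
    the step that produces \<open>X m\<close>.\<close>
  have X: "X m \<in> Kh2 N" for m
    using sol by (cases m) (auto simp: SP_PFEM_step_def)
  have dec: "energy \<gamma> N (X (Suc m)) \<le> energy \<gamma> N (X m)" for m
    using SP_PFEM_step_energy_le[OF _ assms(3-5) X] assms(1) sol
    unfolding anisotropy_def by blast
  have "energy \<gamma> N (X m) \<le> energy \<gamma> N (X 0)" for m
    by (induction m) (auto intro: order_trans[OF dec])
  then show ?thesis using dec by (simp add: energy_def)
qed

end
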